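(* Fix $\alpha>-1$. For $n\ge0$ let $$\widetilde L_n^\alpha(x)=\frac{e^{-x}x^{\alpha}}{n!}\frac{d^n}{dx^n}\big(e^{x}x^{n-\alpha}\big),\qquad x\in(0,\infty),$$ which is a polynomial in $x$. Then the function $w(x,t)=(1-t)^{\alpha-1}e^{xt/(1-t)}$, $x\in(0,\infty)$, $t<1$, is a generating function of the family $\{\widetilde L_n^\alpha\}_{n\ge0}$, i.e. $w(x,t)=\sum_{n=0}^\infty\widetilde L_n^\alpha(x)t^n$ for $|t|<1$, and the recurrence relation $$(n+1)\widetilde L^\alpha_{n+1}(x)+(\alpha-1-x-2n)\widetilde L^\alpha_n(x)+(n-\alpha)\widetilde L^\alpha_{n-1}(x)=0,\quad n\ge1,\qquad \widetilde L^\alpha_0(x)=1,\quad \widetilde L^\alpha_{-1}(x)=0,$$ is satisfied (with $\widetilde L^\alpha_{-1}:=0$). Let $$\widetilde{\mathcal L}_\alpha=x\frac{d^2}{dx^2}+(-\alpha+1+x)\frac{d}{dx}.$$ Then $\widetilde{\mathcal L}_\alpha$ is formally self-adjoint with respect to the inverse Laguerre measure $x^{-\alpha}e^{x}dx$ on $(0,\infty)$. Moreover, $\widetilde{\mathcal L}_\alpha\widetilde L^\alpha_n=n\widetilde L^\alpha_n$ for all $n\ge0$.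
   Context: A second order differential operator $T$ on an open interval $I$ is formally self-adjoint with respect to a measure $\mu$ on $I$ if $\int_I (Tf)\,g\,d\mu=\int_I f\,(Tg)\,d\mu$ for all smooth functions $f,g$ with compact support in $I$. *)

theory Defs
  imports "HOL-Analysis.Analysis" "HOL-Computational_Algebra.Polynomial"
begin

(* Functions on an open set I of reals are represented by total functions; only their values on I
   matter below, and deriv at a point of I depends only on the values near that point.
   The unspecified value that deriv has at points of non-differentiability plays no role: smoothness
   asks every iterated derivative to be differentiable on I, and the functions differentiated in
   inv_laguerre are analytic on {0<..}. *)

definition smooth_on :: "real set \<Rightarrow> (real \<Rightarrow> real) \<Rightarrow> bool" where
  "smooth_on I f \<longleftrightarrow> (\<forall>k. (deriv ^^ k) f differentiable_on I)"

definition test_function :: "real set \<Rightarrow> (real \<Rightarrow> real) \<Rightarrow> bool" where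
  "test_function I f \<longleftrightarrow> smooth_on I f \<and>
     compact (closure (support_on I f)) \<and> closure (support_on I f) \<subseteq> I"

(* The underlying set of M is I. Integrability is part of the definition because the Bochner
   integral of a non-integrable function is 0 by convention, which would make the equation
   hold for the wrong reason. *)
definition formally_self_adjoint ::
  "real set \<Rightarrow> real measure \<Rightarrow> ((real \<Rightarrow> real) \<Rightarrow> real \<Rightarrow> real) \<Rightarrow> bool" where
  "formally_self_adjoint I M T \<longleftrightarrow>
     (\<forall>f g. test_function I f \<longrightarrow> test_function I g \<longrightarrow>
        integrable M (\<lambda>x. T f x * g x) \<and> integrable M (\<lambda>x. f x * T g x) \<and>
        (LINT x|M. T f x * g x) = (LINT x|M. f x * T g x))"

definition inv_laguerre :: "real \<Rightarrow> nat \<Rightarrow> real \<Rightarrow> real" where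
  "inv_laguerre \<alpha> n x =
     exp (- x) * x powr \<alpha> / fact n * (deriv ^^ n) (\<lambda>y. exp y * y powr (real n - \<alpha>)) x"

(* The family extended by 0 to negative indices, so that index -1 is meaningful. *)
definition inv_laguerre_ext :: "real \<Rightarrow> int \<Rightarrow> real \<Rightarrow> real" where
  "inv_laguerre_ext \<alpha> k x = (if k < 0 then 0 else inv_laguerre \<alpha> (nat k) x)"

definition inv_laguerre_gen :: "real \<Rightarrow> real \<Rightarrow> real \<Rightarrow> real" where
  "inv_laguerre_gen \<alpha> x t = (1 - t) powr (\<alpha> - 1) * exp (x * t / (1 - t))"

definition inv_laguerre_op :: "real \<Rightarrow> (real \<Rightarrow> real) \<Rightarrow> real \<Rightarrow> real" where
  "inv_laguerre_op \<alpha> f x = x * (deriv ^^ 2) f x + (- \<alpha> + 1 + x) * deriv f x"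

definition inv_laguerre_measure :: "real \<Rightarrow> real measure" where
  "inv_laguerre_measure \<alpha> =
     density (restrict_space lborel {0<..}) (\<lambda>x. ennreal (x powr (- \<alpha>) * exp x))"

end

theory Submission
  imports Defs
begin

text \<open>All parts except self-adjointness rest on the explicit coefficients. By the Leibniz rule
(\<open>higher_deriv_exp_powr\<close>, \<open>coeff_rodrigues_poly\<close>), the Rodrigues formula gives on \<open>x > 0\<close>
\[ L_n(x) = \sum_{k \le n} {n - \alpha \choose n - k} \frac{x^k}{k!}
     = \sum_{k \le n} \frac{(k + 1 - \alpha)_{n-k}}{k!\,(n-k)!} x^k , \]
where $(c)_m$ is the Pochhammer symbol. These coefficients satisfy linear relations with polynomial
multipliers; the three-term recurrence and the eigenvalue equation are two of them
(\<open>inv_laguerre_poly_recurrence\<close>, \<open>inv_laguerre_poly_eigen\<close>).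

For the generating function, expand
\[ (1-t)^{\alpha-1} e^{xt/(1-t)} = \sum_k \frac{x^k t^k}{k!} (1-t)^{-(k+1-\alpha)}
     = \sum_{k,m} \frac{x^k}{k!} \frac{(k+1-\alpha)_m}{m!} t^{k+m} . \]
The double series converges absolutely for $|t| < 1$ (\<open>generating_double_series\<close>), and collecting the
terms with $k + m = n$ produces exactly $L_n(x) t^n$.

Self-adjointness is Lagrange's identity: after multiplication by the weight the operator has the
Sturm-Liouville form $(p f')'$, so the two integrands differ by the derivative of a weighted Wronskian
(\<open>sturm_liouville_derivative\<close>), which vanishes near both ends of the half-line.\<close>

section \<open>Coefficients from the Rodrigues formula\<close>

text \<open>One differentiation sends \<open>e\<^sup>y y\<^sup>c R(y)\<close> to \<open>e\<^sup>y y\<^sup>c\<^sup>-\<^sup>1 (c R + y (R + R'))\<close>. Starting from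
\<open>c = b\<close> and \<open>R = 1\<close>, the recursion below collects the polynomial factor after \<open>k\<close> steps.\<close>

primrec rodrigues_poly :: "real \<Rightarrow> nat \<Rightarrow> real poly" where
  "rodrigues_poly b 0 = 1"
| "rodrigues_poly b (Suc k) =
     smult (b - real k) (rodrigues_poly b k) + pCons 0 (rodrigues_poly b k + pderiv (rodrigues_poly b k))"

lemma deriv_cong_on_open:
  fixes f g :: "real \<Rightarrow> real"
  assumes "open S" "x \<in> S" "\<And>y. y \<in> S \<Longrightarrow> f y = g y"
  shows "deriv f x = deriv g x"
proof (rule deriv_cong_ev)
  have "eventually (\<lambda>y. y \<in> S) (nhds x)"
    using assms(1,2) by (rule eventually_nhds_in_open)
  then show "eventually (\<lambda>y. f y = g y) (nhds x)"
    by (rule eventually_mono) (rule assms(3))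
qed simp

lemma higher_deriv_exp_powr:
  assumes "x > 0"
  shows "(deriv ^^ k) (\<lambda>y. exp y * y powr b) x
           = exp x * x powr (b - real k) * poly (rodrigues_poly b k) x"
  using assms
proof (induction k arbitrary: x)
  case 0
  then show ?case by simp
next
  case (Suc k)
  have p: "x powr (b - real k) = x * x powr (b - real (Suc k))"
    using powr_add[of x 1 "b - real (Suc k)"] Suc.prems by simp
  have "(deriv ^^ Suc k) (\<lambda>y. exp y * y powr b) x
          = deriv (\<lambda>y. exp y * y powr (b - real k) * poly (rodrigues_poly b k) y) x"
    unfolding funpow.simps comp_def
    by (rule deriv_cong_on_open[of "{0<..}"]) (use Suc in auto)
  also have "\<dots> = (exp x * x powr (b - real k) + exp x * ((b - real k) * x powr (b - real (Suc k))))
        * poly (rodrigues_poly b k) x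
      + exp x * x powr (b - real k) * poly (pderiv (rodrigues_poly b k)) x"
    using DERIV_mult[OF DERIV_mult[OF DERIV_exp[of x] has_real_derivative_powr[OF Suc.prems, of "b - real k"]]
        poly_DERIV[of "rodrigues_poly b k" x]]
    by (intro DERIV_imp_deriv) (simp add: algebra_simps)
  also have "\<dots> = exp x * x powr (b - real (Suc k)) * poly (rodrigues_poly b (Suc k)) x"
    unfolding p by (simp add: algebra_simps)
  finally show ?case .
qed

text \<open>This is the Leibniz rule for \<open>e\<^sup>y y\<^sup>b\<close>: in the term with \<open>j\<close> derivatives on the exponential, the remaining
\<open>k - j\<close> turn \<open>y\<^sup>b\<close> into the falling factorial \<open>b (b - 1) \<dots> (b - (k - j) + 1)\<close> times \<open>y\<^sup>b\<^sup>-\<^sup>k\<^sup>+\<^sup>j\<close>. The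
falling factorial is written as a factorial times a generalised binomial coefficient. The induction
step is Pascal's rule.\<close>

lemma coeff_rodrigues_poly:
  "coeff (rodrigues_poly b k) j = real (k choose j) * (fact (k - j) * (b gchoose (k - j)))"
proof (induction k arbitrary: j)
  case 0
  then show ?case by (cases j) auto
next
  case (Suc k)
  have step: "fact (Suc d) * (b gchoose Suc d) = (b - real d) * (fact d * (b gchoose d))" for d
    using arg_cong[OF gbinomial_mult_1[of b d], of "(*) (fact d)"]
    by (simp add: algebra_simps del: of_nat_Suc)
  show ?case
  proof (cases j)
    case 0
    then show ?thesis using step[of k] by (simp add: Suc.IH del: fact_Suc)
  next
    case (Suc i)
    show ?thesis
    proof (cases "j \<le> k")
      case True
      then obtain d where "k = j + d" using le_Suc_ex by blast
      have e: "Suc k - j = Suc d" "k - j = d" "k - i = Suc d" "Suc k choose j = (k choose i) + (k choose j)"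
        using \<open>k = j + d\<close> Suc by simp_all
      have "coeff (rodrigues_poly b (Suc k)) j =
          (b - real k + real j) * coeff (rodrigues_poly b k) j + coeff (rodrigues_poly b k) i"
        using Suc by (simp add: coeff_pderiv algebra_simps)
      also have "\<dots> = real (k choose j) * ((b - real d) * (fact d * (b gchoose d)))
          + real (k choose i) * (fact (Suc d) * (b gchoose Suc d))"
        unfolding Suc.IH e using \<open>k = j + d\<close> by (simp add: mult.left_commute del: fact_Suc)
      finally show ?thesis
        unfolding step[symmetric] e by (simp add: algebra_simps del: fact_Suc)
    next
      case False
      then show ?thesis using Suc by (auto simp add: Suc.IH coeff_pderiv binomial_eq_0)
    qed
  qed
qed

definition inv_laguerre_poly :: "real \<Rightarrow> nat \<Rightarrow> real poly" where
  "inv_laguerre_poly \<alpha> n = smult (1 / fact n) (rodrigues_poly (real n - \<alpha>) n)"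

lemma inv_laguerre_eq_poly:
  assumes "x > 0"
  shows "inv_laguerre \<alpha> n x = poly (inv_laguerre_poly \<alpha> n) x"
  using assms unfolding inv_laguerre_def inv_laguerre_poly_def
  by (simp add: higher_deriv_exp_powr exp_minus powr_minus field_simps)

lemma coeff_inv_laguerre_poly:
  "coeff (inv_laguerre_poly \<alpha> n) k =
     (if k \<le> n then ((real n - \<alpha>) gchoose (n - k)) / fact k else 0)"
  unfolding inv_laguerre_poly_def
  by (auto simp: coeff_rodrigues_poly binomial_eq_0 binomial_fact field_simps)

text \<open>Indexing the coefficients by \<open>k\<close> and the codegree \<open>d = n - k\<close> removes truncated subtraction, and the
Pochhammer symbol makes neighbouring coefficients differ by visible linear factors. The same form is
what the binomial series produces in the generating function.\<close>

lemma coeff_inv_laguerre_poly_pochhammer: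
  "coeff (inv_laguerre_poly \<alpha> (k + d)) k = pochhammer (real k - \<alpha> + 1) d / (fact k * fact d)"
  by (simp add: coeff_inv_laguerre_poly gbinomial_pochhammer' algebra_simps)

lemma coeff_inv_laguerre_poly_eq_0:
  "n < k \<Longrightarrow> coeff (inv_laguerre_poly \<alpha> n) k = 0"
  by (simp add: coeff_inv_laguerre_poly)

section \<open>Recurrence relation and differential equation\<close>

text \<open>In the coefficient of \<open>x\<^sup>k\<close>, all four contributions are multiples of the Pochhammer symbol
\<open>P\<close> that belongs to the lowest index \<open>m\<close>, and the cofactors cancel by a polynomial identity in \<open>\<alpha>\<close>,
\<open>k\<close> and \<open>d = m - k\<close>. The two top degrees \<open>k = m + 1\<close> and \<open>k = m + 2\<close> are separate because there some of
the contributions vanish.\<close>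

lemma inv_laguerre_poly_recurrence:
  "smult (real (Suc m) + 1) (inv_laguerre_poly \<alpha> (Suc (Suc m)))
   + smult (\<alpha> - 1 - 2 * real (Suc m)) (inv_laguerre_poly \<alpha> (Suc m)) - pCons 0 (inv_laguerre_poly \<alpha> (Suc m))
   + smult (real (Suc m) - \<alpha>) (inv_laguerre_poly \<alpha> m) = 0"  (is "?P = 0")
proof (rule poly_eqI)
  fix k
  let ?c = "\<lambda>n. coeff (inv_laguerre_poly \<alpha> n)"
  \<comment> \<open>The factor \<open>k\<close> comes from \<open>1 / (k - 1)! = k / k!\<close> and covers the vanishing constant term as well.\<close>
  have below: "coeff (pCons 0 (inv_laguerre_poly \<alpha> (k + d))) k =
      real k * pochhammer (real k - \<alpha>) (Suc d) / (fact k * fact (Suc d))" for d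
  proof (cases k)
    case (Suc j)
    have "coeff (pCons 0 (inv_laguerre_poly \<alpha> (k + d))) k
        = pochhammer (real k - \<alpha>) (Suc d) / (fact j * fact (Suc d))"
      using coeff_inv_laguerre_poly_pochhammer[of \<alpha> j "Suc d"] Suc
      by (simp add: algebra_simps del: fact_Suc)
    moreover have "fact k = real k * fact j" "real k \<noteq> 0"
      using Suc by simp_all
    ultimately show ?thesis
      by (simp del: fact_Suc)
  qed simp
  consider "k \<le> m" | "k = Suc m" | "k = Suc (Suc m)" | "k > Suc (Suc m)" by linarith
  then show "coeff ?P k = coeff 0 k"
  proof cases
    case 1
    then obtain d where m: "m = k + d" using le_Suc_ex by blast
    define P where "P = pochhammer (real k - \<alpha> + 1) d"
    define F :: real where "F = fact k * fact d"
    have F: "F \<noteq> 0" by (simp add: F_def)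
    have c0: "?c m k = P / F"
      unfolding m P_def F_def by (rule coeff_inv_laguerre_poly_pochhammer)
    have c1: "?c (Suc m) k = P * (real k - \<alpha> + 1 + d) / (F * (d + 1))"
      using coeff_inv_laguerre_poly_pochhammer[of \<alpha> k "Suc d"]
      by (simp add: m P_def F_def pochhammer_Suc algebra_simps)
    have c2: "?c (Suc (Suc m)) k =
        P * (real k - \<alpha> + 1 + d) * (real k - \<alpha> + 2 + d) / (F * (d + 1) * (d + 2))"
      using coeff_inv_laguerre_poly_pochhammer[of \<alpha> k "Suc (Suc d)"]
      by (simp add: m P_def F_def pochhammer_Suc algebra_simps)
    have cx: "coeff (pCons 0 (inv_laguerre_poly \<alpha> (Suc m))) k =
        real k * ((real k - \<alpha>) * P * (real k - \<alpha> + 1 + d)) / (F * (d + 1) * (d + 2))"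
    proof -
      have e: "pochhammer (real k - \<alpha>) (Suc (Suc d)) = (real k - \<alpha>) * (P * (real k - \<alpha> + 1 + d))"
        unfolding P_def pochhammer_rec[of "real k - \<alpha>"] pochhammer_Suc[of "real k - \<alpha> + 1"] ..
      show ?thesis
        using below[of "Suc d", unfolded e] by (simp add: m F_def algebra_simps)
    qed
    have "real m = real k + real d" by (simp add: m)
    then show ?thesis
      using F by (simp add: c0 c1 c2 cx divide_simps add_nonneg_eq_0_iff) (simp add: algebra_simps)
  next
    case 2
    define F :: real where "F = fact k"
    have F: "F \<noteq> 0" by (simp add: F_def)
    have rm: "real m = real k - 1" using 2 by simp
    have c0: "?c m k = 0"
      using 2 by (simp add: coeff_inv_laguerre_poly_eq_0)
    have c1: "?c (Suc m) k = 1 / F"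
      using coeff_inv_laguerre_poly_pochhammer[of \<alpha> k 0] 2 by (simp add: F_def)
    have c2: "?c (Suc (Suc m)) k = (real k - \<alpha> + 1) / F"
      using coeff_inv_laguerre_poly_pochhammer[of \<alpha> k 1] 2 by (simp add: F_def)
    have cx: "coeff (pCons 0 (inv_laguerre_poly \<alpha> (Suc m))) k = real k * (real k - \<alpha>) / F"
      using below[of 0] unfolding 2[symmetric] by (simp add: F_def)
    show ?thesis
      using F by (simp add: rm c0 c1 c2 cx divide_simps) (simp add: algebra_simps)
  next
    case 3
    have "?c (Suc (Suc m)) k = 1 / fact k"
      using coeff_inv_laguerre_poly_pochhammer[of \<alpha> k 0] 3 by (simp del: fact_Suc)
    moreover have "coeff (pCons 0 (inv_laguerre_poly \<alpha> (Suc m))) k = real k / fact k"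
    proof -
      have "?c (Suc m) (Suc m) = 1 / fact (Suc m)"
        using coeff_inv_laguerre_poly_pochhammer[of \<alpha> "Suc m" 0] by (simp del: fact_Suc)
      moreover have "fact k = real k * fact (Suc m)" "real k \<noteq> 0"
        using 3 by (simp_all only: fact_Suc of_nat_fact)
      ultimately show ?thesis
        using 3 by (simp del: fact_Suc of_nat_Suc)
    qed
    ultimately show ?thesis
      using 3 by (simp add: coeff_inv_laguerre_poly_eq_0 del: fact_Suc)
  next
    case 4
    then show ?thesis by (cases k) (simp_all add: coeff_inv_laguerre_poly_eq_0)
  qed
qed

text \<open>Comparing coefficients, the differential equation is the two-term recurrence
\<open>(k + 1) (k + 1 - \<alpha>) c\<^sub>k\<^sub>+\<^sub>1 = (n - k) c\<^sub>k\<close>, the ratio rule for the binomial coefficients in \<open>c\<^sub>k\<close>.\<close>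

lemma inv_laguerre_poly_eigen:
  fixes \<alpha> n defines "p \<equiv> inv_laguerre_poly \<alpha> n"
  shows "pCons 0 (pderiv (pderiv p)) + smult (1 - \<alpha>) (pderiv p) + pCons 0 (pderiv p) = smult (real n) p"
proof (rule poly_eqI)
  fix k
  have ratio: "(real k + 1) * (real k + 1 - \<alpha>) * coeff p (Suc k) = (real n - real k) * coeff p k"
  proof (cases "k < n")
    case True
    then obtain d where n: "n = Suc k + d" by (metis less_iff_Suc_add add_Suc)
    define P where "P = pochhammer (real k + 2 - \<alpha>) d"
    define F :: real where "F = fact k * fact d"
    have "F \<noteq> 0" by (simp add: F_def)
    have "(real k + 1) * coeff p (Suc k) = P / F"
      using coeff_inv_laguerre_poly_pochhammer[of \<alpha> "Suc k" d]
      by (simp add: p_def P_def F_def n divide_simps add_nonneg_eq_0_iff) (simp add: algebra_simps)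
    moreover have "(real d + 1) * coeff p k = (real k + 1 - \<alpha>) * (P / F)"
      using coeff_inv_laguerre_poly_pochhammer[of \<alpha> k "Suc d"]
      by (simp add: p_def P_def F_def n pochhammer_rec divide_simps add_nonneg_eq_0_iff) (simp add: algebra_simps)
    ultimately have "(real d + 1) * coeff p k = (real k + 1 - \<alpha>) * ((real k + 1) * coeff p (Suc k))"
      by simp
    moreover have "real n - real k = real d + 1"
      by (simp add: n)
    ultimately show ?thesis
      by (metis mult.assoc mult.commute)
  next
    case False
    then show ?thesis by (cases "k = n") (auto simp: p_def coeff_inv_laguerre_poly_eq_0)
  qed
  show "coeff (pCons 0 (pderiv (pderiv p)) + smult (1 - \<alpha>) (pderiv p) + pCons 0 (pderiv p)) k
      = coeff (smult (real n) p) k"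
    using ratio by (cases k) (auto simp: coeff_pderiv algebra_simps)
qed

lemma deriv_eq_poly_on_pos:
  fixes f :: "real \<Rightarrow> real"
  assumes "\<And>y. y > 0 \<Longrightarrow> f y = poly p y" "x > 0"
  shows "deriv f x = poly (pderiv p) x"
  using deriv_cong_on_open[of "{0<..}" x f "poly p"] assms by (simp add: DERIV_imp_deriv poly_DERIV)

lemma inv_laguerre_op_poly:
  fixes f :: "real \<Rightarrow> real"
  assumes "\<And>y. y > 0 \<Longrightarrow> f y = poly p y" "x > 0"
  shows "inv_laguerre_op \<alpha> f x =
    poly (pCons 0 (pderiv (pderiv p)) + smult (1 - \<alpha>) (pderiv p) + pCons 0 (pderiv p)) x"
proof -
  have "deriv f y = poly (pderiv p) y" if "y > 0" for y
    using assms(1) that by (rule deriv_eq_poly_on_pos)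
  then show ?thesis
    using assms(2) deriv_eq_poly_on_pos[of "deriv f" "pderiv p" x]
    by (simp add: inv_laguerre_op_def numeral_2_eq_2 algebra_simps)
qed

section \<open>Generating function\<close>

text \<open>Newton's binomial series for a negated exponent; negating the upper argument of the binomial
coefficient absorbs all signs into the Pochhammer symbol.\<close>

lemma inverse_binomial_sums:
  fixes c t :: real
  assumes "\<bar>t\<bar> < 1"
  shows "(\<lambda>m. pochhammer c m / fact m * t ^ m) sums (1 - t) powr (- c)"
proof -
  have "(- c gchoose m) * (- t) ^ m = pochhammer c m / fact m * t ^ m" for m
  proof -
    have "(- c gchoose m) * (- t) ^ m = ((- 1) ^ m * (- 1) ^ m) * (pochhammer c m / fact m * t ^ m)"
      unfolding gbinomial_pochhammer power_minus[of t] by simp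
    then show ?thesis by (simp only: minus_one_mult_self mult_1)
  qed
  then show ?thesis
    using gen_binomial_real[of "- t" "- c"] assms by simp
qed

lemma abs_pochhammer_le:
  fixes c d :: real
  assumes "\<bar>c\<bar> \<le> d"
  shows "\<bar>pochhammer c m\<bar> \<le> pochhammer d m"
  unfolding pochhammer_prod abs_prod using assms by (intro prod_mono) auto

text \<open>The convergence is absolute: the series with \<open>\<bar>c\<bar>\<close> and \<open>\<bar>t\<bar>\<close> in place of \<open>c\<close> and \<open>t\<close>, again a binomial series,
is a termwise majorant.\<close>

lemma inverse_binomial_has_sum:
  fixes c t :: real
  assumes "\<bar>t\<bar> < 1"
  shows "((\<lambda>m. pochhammer c m / fact m * t ^ m) has_sum (1 - t) powr (- c)) UNIV"
proof (rule norm_summable_imp_has_sum)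
  have "summable (\<lambda>m. pochhammer \<bar>c\<bar> m / fact m * \<bar>t\<bar> ^ m)"
    using inverse_binomial_sums[of "\<bar>t\<bar>" "\<bar>c\<bar>"] assms by (auto simp: sums_iff)
  then show "summable (\<lambda>m. norm (pochhammer c m / fact m * t ^ m))"
    by (rule summable_comparison_test'[where N = 0])
       (auto simp: abs_mult power_abs intro!: mult_right_mono divide_right_mono abs_pochhammer_le)
qed (rule inverse_binomial_sums[OF assms])

lemma exp_series_has_sum:
  fixes b x t :: real
  assumes "\<bar>t\<bar> < 1"
  shows "((\<lambda>k. x ^ k / fact k * t ^ k * (1 - t) powr (- (real k + b))) has_sum
            (1 - t) powr (- b) * exp (x * t / (1 - t))) UNIV"
proof -
  have summand: "x ^ k / fact k * t ^ k * (1 - t) powr (- (real k + b))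
      = (1 - t) powr (- b) * ((x * t / (1 - t)) ^ k /\<^sub>R fact k)" for k
  proof -
    have "(1 - t) powr (- (real k + b)) = (1 - t) powr (- b - real k)"
      by (rule arg_cong[where f = "(powr) (1 - t)"]) simp
    also have "\<dots> = (1 - t) powr (- b) / (1 - t) ^ k"
      using assms by (simp only: powr_diff) (simp add: powr_realpow)
    finally show ?thesis
      by (simp add: power_divide power_mult_distrib divide_inverse power_inverse mult_ac)
  qed
  have "((\<lambda>k. (x * t / (1 - t)) ^ k /\<^sub>R fact k) has_sum exp (x * t / (1 - t))) UNIV"
    by (rule norm_summable_imp_has_sum[OF summable_norm_exp exp_converges])
  then show ?thesis
    unfolding summand by (rule has_sum_cmult_right)
qed

text \<open>With \<open>b = 1 - \<alpha>\<close> the sum is the generating function. Expanding the exponential in powers of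
\<open>x t / (1 - t)\<close> leaves the powers \<open>(1 - t)\<^sup>-\<^sup>k\<^sup>-\<^sup>b\<close>, and each of these is a binomial series in \<open>t\<close>. The array
of all terms is unconditionally summable, because the array for \<open>\<bar>x\<bar>\<close>, \<open>\<bar>b\<bar>\<close>, \<open>\<bar>t\<bar>\<close> has nonnegative terms,
dominates it, and has finite iterated sums of the same shape.\<close>

lemma generating_double_series:
  fixes b x t :: real
  assumes "\<bar>t\<bar> < 1"
  shows "((\<lambda>(k, m). x ^ k / fact k * t ^ k * (pochhammer (real k + b) m / fact m * t ^ m)) has_sum
            (1 - t) powr (- b) * exp (x * t / (1 - t))) (UNIV \<times> UNIV)"
    (is "(?f has_sum _) _")
proof (rule has_sum_SigmaI)
  show "((\<lambda>m. ?f (k, m)) has_sum x ^ k / fact k * t ^ k * (1 - t) powr (- (real k + b))) UNIV" for k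
    unfolding prod.case by (rule has_sum_cmult_right[OF inverse_binomial_has_sum[OF assms]])
  let ?g = "\<lambda>(k, m). \<bar>x\<bar> ^ k / fact k * \<bar>t\<bar> ^ k * (pochhammer (real k + \<bar>b\<bar>) m / fact m * \<bar>t\<bar> ^ m)"
  have abs_t: "\<bar>\<bar>t\<bar>\<bar> < 1" using assms by simp
  have "?g summable_on UNIV \<times> UNIV"
  proof (rule summable_on_SigmaI)
    show "((\<lambda>m. ?g (k, m)) has_sum \<bar>x\<bar> ^ k / fact k * \<bar>t\<bar> ^ k * (1 - \<bar>t\<bar>) powr (- (real k + \<bar>b\<bar>))) UNIV" for k
      unfolding prod.case by (rule has_sum_cmult_right[OF inverse_binomial_has_sum[OF abs_t]])
    show "(\<lambda>k. \<bar>x\<bar> ^ k / fact k * \<bar>t\<bar> ^ k * (1 - \<bar>t\<bar>) powr (- (real k + \<bar>b\<bar>))) summable_on UNIV"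
      using exp_series_has_sum[OF abs_t] by (auto simp: summable_on_def)
    show "0 \<le> ?g (k, m)" for k m
      by (auto intro!: mult_nonneg_nonneg divide_nonneg_nonneg simp: pochhammer_prod prod_nonneg)
  qed
  then have "(\<lambda>p. norm (?f p)) summable_on UNIV \<times> UNIV"
    by (rule summable_on_comparison_test)
       (auto simp: abs_mult power_abs intro!: mult_left_mono mult_right_mono divide_right_mono abs_pochhammer_le)
  then show "?f summable_on UNIV \<times> UNIV"
    by (rule abs_summable_summable)
qed (rule exp_series_has_sum[OF assms])

lemma has_sum_diagonals_imp_sums:
  fixes f :: "nat \<times> nat \<Rightarrow> real"
  assumes "(f has_sum S) (UNIV \<times> UNIV)"
  shows "(\<lambda>n. \<Sum>k\<le>n. f (k, n - k)) sums S"
proof -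
  have "((\<lambda>(n, k). f (k, n - k)) has_sum S) (SIGMA n:UNIV. {..n})"
    using assms
    by (subst has_sum_reindex_bij_witness[of _ "\<lambda>(k, m). (k + m, k)" "\<lambda>(n, k). (k, n - k)"  _ f _ S]) auto
  then have "((\<lambda>n. \<Sum>k\<le>n. f (k, n - k)) has_sum S) UNIV"
    by (rule has_sum_SigmaD) (auto intro: has_sum_finite)
  then show ?thesis by (rule has_sum_imp_sums)
qed

lemma poly_inv_laguerre_poly:
  "poly (inv_laguerre_poly \<alpha> n) x = (\<Sum>k\<le>n. coeff (inv_laguerre_poly \<alpha> n) k * x ^ k)"
  unfolding poly_altdef
  by (intro sum.mono_neutral_left)
     (auto intro!: degree_le simp: coeff_inv_laguerre_poly_eq_0 coeff_eq_0)

lemma inv_laguerre_poly_generating_function: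
  assumes "\<bar>t\<bar> < 1"
  shows "(\<lambda>n. poly (inv_laguerre_poly \<alpha> n) x * t ^ n) sums inv_laguerre_gen \<alpha> x t"
proof -
  have diagonal: "(\<Sum>k\<le>n. case (k, n - k) of (k, m) \<Rightarrow>
        x ^ k / fact k * t ^ k * (pochhammer (real k + (1 - \<alpha>)) m / fact m * t ^ m))
      = poly (inv_laguerre_poly \<alpha> n) x * t ^ n" for n
    unfolding poly_inv_laguerre_poly sum_distrib_right
  proof (rule sum.cong[OF refl])
    fix k assume "k \<in> {..n}"
    then obtain d where n: "n = k + d" using le_Suc_ex by auto
    show "(case (k, n - k) of (k, m) \<Rightarrow>
        x ^ k / fact k * t ^ k * (pochhammer (real k + (1 - \<alpha>)) m / fact m * t ^ m))
      = coeff (inv_laguerre_poly \<alpha> n) k * x ^ k * t ^ n"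
      unfolding n coeff_inv_laguerre_poly_pochhammer by (simp add: power_add algebra_simps)
  qed
  show ?thesis
    using has_sum_diagonals_imp_sums[OF generating_double_series[OF assms, of x "1 - \<alpha>"]]
    unfolding diagonal by (simp add: inv_laguerre_gen_def)
qed

section \<open>Formal self-adjointness\<close>

lemma test_function_deriv:
  assumes "test_function I f" "open I" "x \<in> I"
  shows "((deriv ^^ k) f has_real_derivative (deriv ^^ Suc k) f x) (at x)"
proof -
  have "(deriv ^^ k) f differentiable (at x)"
    using assms unfolding test_function_def smooth_on_def differentiable_on_def
    by (metis at_within_open)
  then show ?thesis
    by (simp add: DERIV_deriv_iff_real_differentiable)
qed

text \<open>A compact subset of the half-line stays away from both ends. Strict inequalities are asserted so
that the function vanishes at the endpoints \<open>a\<close> and \<open>b\<close> themselves.\<close>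

lemma test_function_support_pos:
  assumes "test_function {0<..} f"
  obtains a b where "0 < a" "\<And>x. x > 0 \<Longrightarrow> f x \<noteq> 0 \<Longrightarrow> a < x \<and> x < b"
proof -
  define K where "K = closure (support_on {0<..} f)"
  have K: "compact K" "K \<subseteq> {0<..}"
    using assms by (auto simp: test_function_def K_def)
  have inK: "x \<in> K" if "x > 0" "f x \<noteq> 0" for x
    using that closure_subset by (fastforce simp: K_def support_on_def)
  show ?thesis
  proof (cases "K = {}")
    case True
    then show ?thesis using inK by (intro that[of 1 1]) auto
  next
    case False
    then obtain l u where l: "l \<in> K" "\<And>x. x \<in> K \<Longrightarrow> l \<le> x"
      and u: "\<And>x. x \<in> K \<Longrightarrow> x \<le> u"
      using compact_attains_inf[OF K(1)] compact_attains_sup[OF K(1)] by metis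
    have "0 < l" using l(1) K(2) by auto
    then show ?thesis using inK l(2) u by (intro that[of "l / 2" "u + 1"]) force+
  qed
qed

lemma has_bochner_integral_inv_laguerre_measure:
  assumes h: "continuous_on {0<..} h"
    and "has_bochner_integral lborel (\<lambda>x. indicator {0<..} x *\<^sub>R (x powr - \<alpha> * exp x * h x)) i"
  shows "has_bochner_integral (inv_laguerre_measure \<alpha>) h i"
  unfolding inv_laguerre_measure_def
proof (rule has_bochner_integral_density)
  have meas: "g \<in> borel_measurable (restrict_space lborel {0<..})"
    if "continuous_on {0<..} g" for g :: "real \<Rightarrow> real"
    using borel_measurable_continuous_on_restrict[OF that]
    by (simp cong: measurable_cong_sets add: sets_restrict_space)
  show "h \<in> borel_measurable (restrict_space lborel {0<..})" by (rule meas[OF h])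
  show "(\<lambda>x. x powr - \<alpha> * exp x) \<in> borel_measurable (restrict_space lborel {0<..})"
    by (rule meas) (auto intro!: continuous_intros)
  show "has_bochner_integral (restrict_space lborel {0<..}) (\<lambda>x. (x powr - \<alpha> * exp x) *\<^sub>R h x) i"
    using assms(2) by (simp add: has_bochner_integral_restrict_space)
qed auto

text \<open>The weight \<open>w = x\<^sup>-\<^sup>\<alpha> e\<^sup>x\<close> is an integrating factor: \<open>w \<cdot> (x f'' + (1 - \<alpha> + x) f') = (p f')'\<close> with
\<open>p = x\<^sup>1\<^sup>-\<^sup>\<alpha> e\<^sup>x\<close>. Hence the difference of the two integrands in the symmetry relation is the derivative of
\<open>p\<close> times the Wronskian (Lagrange's identity).\<close>

lemma sturm_liouville_derivative:
  fixes f g f1 g1 :: "real \<Rightarrow> real"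
  assumes "x > 0"
    and "(f has_real_derivative f1 x) (at x)" "(f1 has_real_derivative f2) (at x)"
    and "(g has_real_derivative g1 x) (at x)" "(g1 has_real_derivative g2) (at x)"
  shows "((\<lambda>y. y powr (1 - \<alpha>) * exp y * (f1 y * g y - f y * g1 y)) has_real_derivative
     x powr - \<alpha> * exp x * ((x * f2 + (- \<alpha> + 1 + x) * f1 x) * g x
        - f x * (x * g2 + (- \<alpha> + 1 + x) * g1 x))) (at x)"
proof -
  have p: "x powr (1 - \<alpha>) = x * x powr - \<alpha>"
    using powr_add[of x 1 "- \<alpha>"] assms(1) by simp
  have "((\<lambda>y. y powr (1 - \<alpha>)) has_real_derivative (1 - \<alpha>) * x powr - \<alpha>) (at x)"
    using has_real_derivative_powr[OF assms(1), of "1 - \<alpha>"] by simp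
  then show ?thesis
    by (rule DERIV_cong[OF DERIV_mult[OF DERIV_mult[OF _ DERIV_exp]
              DERIV_diff[OF DERIV_mult[OF assms(3,4)] DERIV_mult[OF assms(2,5)]]]])
       (simp add: p algebra_simps)
qed

text \<open>Each integrand contains one of the test functions undifferentiated, so it vanishes outside an
interval \<open>[a, b]\<close> with \<open>0 < a\<close> that holds both supports. Everything reduces to integrals of continuous functions on
\<open>[a, b]\<close>, and by Lagrange's identity their difference is a boundary term. That term is zero since \<open>f\<close>
and \<open>g\<close> vanish at \<open>a\<close> and \<open>b\<close>.\<close>

lemma formally_self_adjoint_inv_laguerre_op:
  "formally_self_adjoint {0<..} (inv_laguerre_measure \<alpha>) (inv_laguerre_op \<alpha>)"
  unfolding formally_self_adjoint_def
proof (intro allI impI)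
  fix f g
  assume f: "test_function {0<..} f" and g: "test_function {0<..} g"
  let ?T = "inv_laguerre_op \<alpha>" and ?w = "\<lambda>x. x powr - \<alpha> * exp x"
  obtain a1 b1 where 1: "0 < a1" "\<And>x. x > 0 \<Longrightarrow> f x \<noteq> 0 \<Longrightarrow> a1 < x \<and> x < b1"
    using test_function_support_pos[OF f] by blast
  obtain a2 b2 where 2: "0 < a2" "\<And>x. x > 0 \<Longrightarrow> g x \<noteq> 0 \<Longrightarrow> a2 < x \<and> x < b2"
    using test_function_support_pos[OF g] by blast
  define a where "a = min a1 a2"
  \<comment> \<open>Taking the maximum with \<open>a\<close> keeps the interval nonempty when \<open>f\<close> and \<open>g\<close> are both zero.\<close>
  define b where "b = max a (max b1 b2)"
  have a: "0 < a" and ab: "a \<le> b" using 1(1) 2(1) by (auto simp: a_def b_def)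
  have out: "f x = 0 \<and> g x = 0" if "x > 0" "\<not> (a < x \<and> x < b)" for x
    using 1(2)[of x] 2(2)[of x] that by (force simp: a_def b_def)
  have cont: "continuous_on {0<..} ((deriv ^^ k) h)" if "test_function {0<..} h" for h k
    by (rule DERIV_continuous_on) (use test_function_deriv[OF that] in \<open>blast intro: has_field_derivative_at_within open_greaterThan\<close>)
  have contT: "continuous_on {0<..} (\<lambda>x. ?T u x * v x)"
    if "test_function {0<..} u" "test_function {0<..} v" for u v
    unfolding inv_laguerre_op_def using cont[OF that(1), of 1] cont[OF that(1), of 2] cont[OF that(2), of 0]
    by (auto intro!: continuous_intros)
  define J where "J u v = integral\<^sup>L lborel (\<lambda>x. indicator {a..b} x *\<^sub>R (?w x * (?T u x * v x)))" for u v
  have int: "has_bochner_integral (inv_laguerre_measure \<alpha>) (\<lambda>x. ?T u x * v x) (J u v)"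
    and int': "set_integrable lborel {a..b} (\<lambda>x. ?w x * (?T u x * v x))"
    if uv: "test_function {0<..} u" "test_function {0<..} v"
      and v0: "\<And>x. x > 0 \<Longrightarrow> \<not> (a < x \<and> x < b) \<Longrightarrow> v x = 0" for u v
  proof -
    have "continuous_on {a..b} (\<lambda>x. ?w x * (?T u x * v x))"
      using a by (intro continuous_intros continuous_on_subset[OF contT[OF uv]]) auto
    then show *: "set_integrable lborel {a..b} (\<lambda>x. ?w x * (?T u x * v x))"
      by (rule borel_integrable_atLeastAtMost')
    have "(\<lambda>x. indicator {0<..} x *\<^sub>R (?w x * (?T u x * v x)))
        = (\<lambda>x. indicator {a..b} x *\<^sub>R (?w x * (?T u x * v x)))"
      using a v0 by (fastforce simp: fun_eq_iff indicator_def)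
    then show "has_bochner_integral (inv_laguerre_measure \<alpha>) (\<lambda>x. ?T u x * v x) (J u v)"
      using * by (intro has_bochner_integral_inv_laguerre_measure contT uv)
        (simp add: has_bochner_integral_iff set_integrable_def J_def)
  qed
  have fg: "has_bochner_integral (inv_laguerre_measure \<alpha>) (\<lambda>x. ?T f x * g x) (J f g)"
    "set_integrable lborel {a..b} (\<lambda>x. ?w x * (?T f x * g x))"
    using int[OF f g] int'[OF f g] out by auto
  have gf: "has_bochner_integral (inv_laguerre_measure \<alpha>) (\<lambda>x. ?T g x * f x) (J g f)"
    "set_integrable lborel {a..b} (\<lambda>x. ?w x * (?T g x * f x))"
    using int[OF g f] int'[OF g f] out by auto
  \<comment> \<open>The boundary term: the weighted Wronskian.\<close>
  define W where "W y = y powr (1 - \<alpha>) * exp y * (deriv f y * g y - f y * deriv g y)" for y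
  have W: "(W has_real_derivative ?w x * (?T f x * g x - f x * ?T g x)) (at x)" if "x > 0" for x
    unfolding W_def inv_laguerre_op_def
    using test_function_deriv[OF f, of x 0] test_function_deriv[OF f, of x 1]
      test_function_deriv[OF g, of x 0] test_function_deriv[OF g, of x 1] that
    by (intro sturm_liouville_derivative) (simp_all add: numeral_2_eq_2)
  have "J f g - J g f = integral\<^sup>L lborel (\<lambda>x. indicator {a..b} x *\<^sub>R (?w x * (?T f x * g x - f x * ?T g x)))"
    unfolding J_def using fg(2) gf(2)
    by (subst Bochner_Integration.integral_diff[symmetric])
       (auto simp: set_integrable_def algebra_simps intro!: Bochner_Integration.integral_cong)
  also have "\<dots> = W b - W a"
  proof (rule integral_FTC_atLeastAtMost)
    show "(W has_vector_derivative ?w x * (?T f x * g x - f x * ?T g x)) (at x within {a..b})"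
      if "a \<le> x" "x \<le> b" for x
      using W[of x] that a
      by (simp add: has_real_derivative_iff_has_vector_derivative has_vector_derivative_at_within)
    show "continuous_on {a..b} (\<lambda>x. ?w x * (?T f x * g x - f x * ?T g x))"
    proof -
      have "continuous_on {a..b} (\<lambda>x. ?T u x * v x)"
        if "test_function {0<..} u" "test_function {0<..} v" for u v
        using a by (intro continuous_on_subset[OF contT[OF that]]) auto
      from continuous_on_diff[OF this[OF f g] this[OF g f]]
      have H: "continuous_on {a..b} (\<lambda>x. ?T f x * g x - f x * ?T g x)"
        by (simp add: mult.commute)
      show ?thesis
        by (rule continuous_on_mult[OF _ H]) (use a in \<open>auto intro!: continuous_intros\<close>)
    qed
  qed (use ab in auto)
  also have "\<dots> = 0" using out[of a] out[of b] a ab by (simp add: W_def)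
  finally have J: "J f g = J g f" by simp
  show "integrable (inv_laguerre_measure \<alpha>) (\<lambda>x. ?T f x * g x) \<and>
      integrable (inv_laguerre_measure \<alpha>) (\<lambda>x. f x * ?T g x) \<and>
      (LINT x|inv_laguerre_measure \<alpha>. ?T f x * g x) = (LINT x|inv_laguerre_measure \<alpha>. f x * ?T g x)"
    using fg(1) gf(1) J by (simp add: has_bochner_integral_iff mult.commute)
qed

section \<open>The inverse Laguerre polynomials\<close>

theorem theorem1p2:
  fixes \<alpha> :: real
  assumes "\<alpha> > -1"
  shows "(\<forall>n. \<exists>p :: real poly. \<forall>x>0. inv_laguerre \<alpha> n x = poly p x) \<and>
    (\<forall>x>0. \<forall>t. \<bar>t\<bar> < 1 \<longrightarrow>
       (\<lambda>n. inv_laguerre \<alpha> n x * t ^ n) sums inv_laguerre_gen \<alpha> x t) \<and>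
    (\<forall>n\<ge>1. \<forall>x>0.
       (of_int n + 1) * inv_laguerre_ext \<alpha> (n + 1) x
       + (\<alpha> - 1 - x - 2 * of_int n) * inv_laguerre_ext \<alpha> n x
       + (of_int n - \<alpha>) * inv_laguerre_ext \<alpha> (n - 1) x = 0) \<and>
    (\<forall>x>0. inv_laguerre_ext \<alpha> 0 x = 1 \<and> inv_laguerre_ext \<alpha> (- 1) x = 0) \<and>
    formally_self_adjoint {0<..} (inv_laguerre_measure \<alpha>) (inv_laguerre_op \<alpha>) \<and>
    (\<forall>n. \<forall>x>0. inv_laguerre_op \<alpha> (inv_laguerre \<alpha> n) x = real n * inv_laguerre \<alpha> n x)"
proof (intro conjI allI impI)
  show "\<exists>p :: real poly. \<forall>x>0. inv_laguerre \<alpha> n x = poly p x" for n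
    using inv_laguerre_eq_poly by blast
next
  fix x t :: real
  assume "x > 0" "\<bar>t\<bar> < 1"
  then show "(\<lambda>n. inv_laguerre \<alpha> n x * t ^ n) sums inv_laguerre_gen \<alpha> x t"
    by (simp add: inv_laguerre_eq_poly inv_laguerre_poly_generating_function)
next
  fix n :: int and x :: real
  assume "n \<ge> 1" "x > 0"
  define m where "m = nat (n - 1)"
  have n: "n = int (Suc m)" using \<open>n \<ge> 1\<close> by (simp add: m_def)
  have idx: "nat (n + 1) = Suc (Suc m)" "nat n = Suc m" "nat (n - 1) = m"
    by (simp_all add: n nat_add_distrib)
  have "inv_laguerre_ext \<alpha> (n + 1) x = poly (inv_laguerre_poly \<alpha> (Suc (Suc m))) x"
    "inv_laguerre_ext \<alpha> n x = poly (inv_laguerre_poly \<alpha> (Suc m)) x"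
    "inv_laguerre_ext \<alpha> (n - 1) x = poly (inv_laguerre_poly \<alpha> m) x"
    using \<open>n \<ge> 1\<close> \<open>x > 0\<close> by (simp_all add: inv_laguerre_ext_def inv_laguerre_eq_poly idx)
  then show "(of_int n + 1) * inv_laguerre_ext \<alpha> (n + 1) x
       + (\<alpha> - 1 - x - 2 * of_int n) * inv_laguerre_ext \<alpha> n x
       + (of_int n - \<alpha>) * inv_laguerre_ext \<alpha> (n - 1) x = 0"
    using arg_cong[OF inv_laguerre_poly_recurrence[of m \<alpha>], of "\<lambda>p. poly p x"]
    by (simp add: n algebra_simps)
next
  fix x :: real
  assume "x > 0"
  then show "inv_laguerre_ext \<alpha> 0 x = 1"
    by (simp add: inv_laguerre_ext_def inv_laguerre_eq_poly inv_laguerre_poly_def)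
  show "inv_laguerre_ext \<alpha> (- 1) x = 0"
    by (simp add: inv_laguerre_ext_def)
next
  show "formally_self_adjoint {0<..} (inv_laguerre_measure \<alpha>) (inv_laguerre_op \<alpha>)"
    by (rule formally_self_adjoint_inv_laguerre_op)
next
  fix n and x :: real
  assume "x > 0"
  then show "inv_laguerre_op \<alpha> (inv_laguerre \<alpha> n) x = real n * inv_laguerre \<alpha> n x"
    by (subst inv_laguerre_op_poly[OF inv_laguerre_eq_poly])
       (simp_all only: inv_laguerre_poly_eigen poly_smult inv_laguerre_eq_poly)
qed

end
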